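(* Let $K=(AP,S,R,s_0,I)$ be a Kripke structure, let $\varphi$ be an $\mathrm{ACTL}^*$ formula, and let $\psi$ be a subformula of $\varphi$. If $\varphi$ is bisimulation vacuous in $\psi$ in $K$, then (a) $\varphi$ is structure vacuous in $\psi$ in $K$, and (b) $\varphi$ is syntactically vacuous in $\psi$ in $K$ with respect to $\mathrm{CTL}^*$.
   Context: A Kripke structure $K=(AP,S,R,s_0,I)$ consists of a set $AP$ of atomic propositions, a finite set $S$ of states, a total transition relation $R\subseteq S\times S$, an initial state $s_0$, and a labeling $I:S\to 2^{AP}$. $\mathrm{CTL}^*$ has the standard syntax and semantics (state formulas built from atomic propositions, $\land,\lor,\neg$, and path quantifiers $A,E$ applied to path formulas built with $X$, $U$, $\tilde U$ (release), $F$, $G$); $K\models\varphi$ means $K,s_0\models\varphi$. $\mathrm{ACTL}^*$ is the fragment of $\mathrm{CTL}^*$ in negation normal form (negation only on atomic propositions) in which all path quantifiers are universal. A set of states $Y\subseteq S$ may be used as an atomic proposition, with $K,s\models Y$ iff $s\in Y$. $\varphi[\psi\leftarrow y]$ denotes the result of replacing every occurrence of $\psi$ in $\varphi$ by $y$. For sets $X$ of atomic propositions common to two Kripke structures $K,K'$, a bisimulation with respect to $X$ is a relation $\rho\subseteq S\times S'$ such that whenever $\rho(s,s')$: $I(s)\cap X=I'(s')\cap X$; every $R'$-successor $t'$ of $s'$ has an $R$-successor $t$ of $s$ with $\rho(t,t')$; and every $R$-successor $t$ of $s$ has an $R'$-successor $t'$ of $s'$ with $\rho(t,t')$. $\mathcal{B}(K)$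 is the set of Kripke structures $K'$ for which there is a bisimulation with respect to $AP$ relating $s_0$ and $s'_0$. Syntactic vacuity: $\varphi$ is syntactically vacuous in $\psi$ in $K$ (w.r.t. $\mathrm{CTL}^*$) iff for every $\mathrm{CTL}^*$ state formula $\psi'$, $K\models\varphi \Leftrightarrow K\models\varphi[\psi\leftarrow\psi']$. Structure vacuity: $\varphi$ is structure vacuous in $\psi$ in $K$ iff either $K\models\varphi[\psi\leftarrow Y]$ for all $Y\subseteq S$, or $K\models\neg\varphi[\psi\leftarrow Y]$ for all $Y\subseteq S$. Bisimulation vacuity: $\varphi$ is bisimulation vacuous in $\psi$ in $K$ iff either for all $K'\in\mathcal{B}(K)$ and all $Y\subseteq S'$ (the state space of $K'$), $K'\models\varphi[\psi\leftarrow Y]$; or for all $K'\in\mathcal{B}(K)$ and all $Y\subseteq S'$, $K'\models\neg\varphi[\psi\leftarrow Y]$. *)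

theory Defs
  imports Main
begin

record ('p, 's) kripke =
  AP :: "'p set"
  states :: "'s set"
  trans_rel :: "('s \<times> 's) set"
  init :: 's
  label :: "'s \<Rightarrow> 'p set"

definition kripke_structure :: "('p, 's) kripke \<Rightarrow> bool" where
  "kripke_structure K \<longleftrightarrow>
     finite (states K) \<and>
     trans_rel K \<subseteq> states K \<times> states K \<and>
     (\<forall>s \<in> states K. \<exists>t. (s, t) \<in> trans_rel K) \<and>
     init K \<in> states K \<and>
     (\<forall>s \<in> states K. label K s \<subseteq> AP K)"

definition is_path :: "('p, 's) kripke \<Rightarrow> (nat \<Rightarrow> 's) \<Rightarrow> bool" where
  "is_path K \<pi> \<longleftrightarrow> (\<forall>i. (\<pi> i, \<pi> (Suc i)) \<in> trans_rel K)"

definition suffix :: "nat \<Rightarrow> (nat \<Rightarrow> 's) \<Rightarrow> (nat \<Rightarrow> 's)" where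
  "suffix k \<pi> = (\<lambda>i. \<pi> (k + i))"

text \<open>
  State and path formulas share one datatype. Every state formula of CTL* is also a path
  formula and path formulas are closed under all the connectives, so every element of the
  datatype is a path formula; the state formulas are singled out by \<open>state_formula\<close>.
\<close>

datatype (atoms: 'a) fml =
    Atom 'a
  | Neg "'a fml"
  | And "'a fml" "'a fml"
  | Or "'a fml" "'a fml"
  | AllPaths "'a fml"
  | ExPath "'a fml"
  | Next "'a fml"
  | Until "'a fml" "'a fml"
  | Release "'a fml" "'a fml"
  | Finally "'a fml"
  | Globally "'a fml"
  for map: map_fml

primrec state_formula :: "'a fml \<Rightarrow> bool" where
  "state_formula (Atom a) \<longleftrightarrow> True"
| "state_formula (Neg f) \<longleftrightarrow> state_formula f"
| "state_formula (And f g) \<longleftrightarrow> state_formula f \<and> state_formula g"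
| "state_formula (Or f g) \<longleftrightarrow> state_formula f \<and> state_formula g"
| "state_formula (AllPaths f) \<longleftrightarrow> True"
| "state_formula (ExPath f) \<longleftrightarrow> True"
| "state_formula (Next f) \<longleftrightarrow> False"
| "state_formula (Until f g) \<longleftrightarrow> False"
| "state_formula (Release f g) \<longleftrightarrow> False"
| "state_formula (Finally f) \<longleftrightarrow> False"
| "state_formula (Globally f) \<longleftrightarrow> False"

primrec universal_nnf :: "'a fml \<Rightarrow> bool" where
  "universal_nnf (Atom a) \<longleftrightarrow> True"
| "universal_nnf (Neg f) \<longleftrightarrow> (\<exists>a. f = Atom a)"
| "universal_nnf (And f g) \<longleftrightarrow> universal_nnf f \<and> universal_nnf g"
| "universal_nnf (Or f g) \<longleftrightarrow> universal_nnf f \<and> universal_nnf g"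
| "universal_nnf (AllPaths f) \<longleftrightarrow> universal_nnf f"
| "universal_nnf (ExPath f) \<longleftrightarrow> False"
| "universal_nnf (Next f) \<longleftrightarrow> universal_nnf f"
| "universal_nnf (Until f g) \<longleftrightarrow> universal_nnf f \<and> universal_nnf g"
| "universal_nnf (Release f g) \<longleftrightarrow> universal_nnf f \<and> universal_nnf g"
| "universal_nnf (Finally f) \<longleftrightarrow> universal_nnf f"
| "universal_nnf (Globally f) \<longleftrightarrow> universal_nnf f"

definition ctl_star :: "'p set \<Rightarrow> 'p fml set" where
  "ctl_star P = {\<phi>. atoms \<phi> \<subseteq> P \<and> state_formula \<phi>}"

definition actl_star :: "'p set \<Rightarrow> 'p fml set" where
  "actl_star P = {\<phi> \<in> ctl_star P. universal_nnf \<phi>}"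

primrec subformulas :: "'a fml \<Rightarrow> 'a fml set" where
  "subformulas (Atom a) = {Atom a}"
| "subformulas (Neg f) = insert (Neg f) (subformulas f)"
| "subformulas (And f g) = insert (And f g) (subformulas f \<union> subformulas g)"
| "subformulas (Or f g) = insert (Or f g) (subformulas f \<union> subformulas g)"
| "subformulas (AllPaths f) = insert (AllPaths f) (subformulas f)"
| "subformulas (ExPath f) = insert (ExPath f) (subformulas f)"
| "subformulas (Next f) = insert (Next f) (subformulas f)"
| "subformulas (Until f g) = insert (Until f g) (subformulas f \<union> subformulas g)"
| "subformulas (Release f g) = insert (Release f g) (subformulas f \<union> subformulas g)"
| "subformulas (Finally f) = insert (Finally f) (subformulas f)"
| "subformulas (Globally f) = insert (Globally f) (subformulas f)"

text \<open>\<open>replace \<psi> y \<phi>\<close> is \<open>\<phi>[\<psi> \<leftarrow> y]\<close>.\<close>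

primrec replace :: "'a fml \<Rightarrow> 'a fml \<Rightarrow> 'a fml \<Rightarrow> 'a fml" where
  "replace \<psi> y (Atom a) = (if Atom a = \<psi> then y else Atom a)"
| "replace \<psi> y (Neg f) = (if Neg f = \<psi> then y else Neg (replace \<psi> y f))"
| "replace \<psi> y (And f g) =
     (if And f g = \<psi> then y else And (replace \<psi> y f) (replace \<psi> y g))"
| "replace \<psi> y (Or f g) =
     (if Or f g = \<psi> then y else Or (replace \<psi> y f) (replace \<psi> y g))"
| "replace \<psi> y (AllPaths f) = (if AllPaths f = \<psi> then y else AllPaths (replace \<psi> y f))"
| "replace \<psi> y (ExPath f) = (if ExPath f = \<psi> then y else ExPath (replace \<psi> y f))"
| "replace \<psi> y (Next f) = (if Next f = \<psi> then y else Next (replace \<psi> y f))"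
| "replace \<psi> y (Until f g) =
     (if Until f g = \<psi> then y else Until (replace \<psi> y f) (replace \<psi> y g))"
| "replace \<psi> y (Release f g) =
     (if Release f g = \<psi> then y else Release (replace \<psi> y f) (replace \<psi> y g))"
| "replace \<psi> y (Finally f) = (if Finally f = \<psi> then y else Finally (replace \<psi> y f))"
| "replace \<psi> y (Globally f) = (if Globally f = \<psi> then y else Globally (replace \<psi> y f))"

text \<open>
  Besides ordinary propositions, sets of states may serve as atoms. Formulas over a plain
  proposition type \<open>'p\<close> are embedded along \<open>lift\<close>.
\<close>

datatype ('p, 's) atom = Prop 'p | States "'s set"

abbreviation lift :: "'p fml \<Rightarrow> ('p, 's) atom fml" where
  "lift \<equiv> map_fml Prop"

primrec atom_sat :: "('p, 's) kripke \<Rightarrow> 's \<Rightarrow> ('p, 's) atom \<Rightarrow> bool" where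
  "atom_sat K s (Prop p) \<longleftrightarrow> p \<in> label K s"
| "atom_sat K s (States Y) \<longleftrightarrow> s \<in> Y"

primrec path_sat :: "('p, 's) kripke \<Rightarrow> (nat \<Rightarrow> 's) \<Rightarrow> ('p, 's) atom fml \<Rightarrow> bool" where
  "path_sat K \<pi> (Atom a) \<longleftrightarrow> atom_sat K (\<pi> 0) a"
| "path_sat K \<pi> (Neg f) \<longleftrightarrow> \<not> path_sat K \<pi> f"
| "path_sat K \<pi> (And f g) \<longleftrightarrow> path_sat K \<pi> f \<and> path_sat K \<pi> g"
| "path_sat K \<pi> (Or f g) \<longleftrightarrow> path_sat K \<pi> f \<or> path_sat K \<pi> g"
| "path_sat K \<pi> (AllPaths f) \<longleftrightarrow> (\<forall>\<pi>'. is_path K \<pi>' \<and> \<pi>' 0 = \<pi> 0 \<longrightarrow> path_sat K \<pi>' f)"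
| "path_sat K \<pi> (ExPath f) \<longleftrightarrow> (\<exists>\<pi>'. is_path K \<pi>' \<and> \<pi>' 0 = \<pi> 0 \<and> path_sat K \<pi>' f)"
| "path_sat K \<pi> (Next f) \<longleftrightarrow> path_sat K (suffix 1 \<pi>) f"
| "path_sat K \<pi> (Until f g) \<longleftrightarrow>
     (\<exists>k. path_sat K (suffix k \<pi>) g \<and> (\<forall>j<k. path_sat K (suffix j \<pi>) f))"
| "path_sat K \<pi> (Release f g) \<longleftrightarrow>
     (\<forall>k. path_sat K (suffix k \<pi>) g \<or> (\<exists>j<k. path_sat K (suffix j \<pi>) f))"
| "path_sat K \<pi> (Finally f) \<longleftrightarrow> (\<exists>k. path_sat K (suffix k \<pi>) f)"
| "path_sat K \<pi> (Globally f) \<longleftrightarrow> (\<forall>k. path_sat K (suffix k \<pi>) f)"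

text \<open>Only meaningful for state formulas; the value \<open>False\<close> on temporal operators is a dummy.\<close>

primrec state_sat :: "('p, 's) kripke \<Rightarrow> 's \<Rightarrow> ('p, 's) atom fml \<Rightarrow> bool" where
  "state_sat K s (Atom a) \<longleftrightarrow> atom_sat K s a"
| "state_sat K s (Neg f) \<longleftrightarrow> \<not> state_sat K s f"
| "state_sat K s (And f g) \<longleftrightarrow> state_sat K s f \<and> state_sat K s g"
| "state_sat K s (Or f g) \<longleftrightarrow> state_sat K s f \<or> state_sat K s g"
| "state_sat K s (AllPaths f) \<longleftrightarrow> (\<forall>\<pi>. is_path K \<pi> \<and> \<pi> 0 = s \<longrightarrow> path_sat K \<pi> f)"
| "state_sat K s (ExPath f) \<longleftrightarrow> (\<exists>\<pi>. is_path K \<pi> \<and> \<pi> 0 = s \<and> path_sat K \<pi> f)"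
| "state_sat K s (Next f) \<longleftrightarrow> False"
| "state_sat K s (Until f g) \<longleftrightarrow> False"
| "state_sat K s (Release f g) \<longleftrightarrow> False"
| "state_sat K s (Finally f) \<longleftrightarrow> False"
| "state_sat K s (Globally f) \<longleftrightarrow> False"

lemma path_sat_state_formula:
  "state_formula f \<Longrightarrow> path_sat K \<pi> f \<longleftrightarrow> state_sat K (\<pi> 0) f"
  by (induction f) auto

definition models :: "('p, 's) kripke \<Rightarrow> ('p, 's) atom fml \<Rightarrow> bool" (infix "\<Turnstile>" 50) where
  "K \<Turnstile> \<phi> \<longleftrightarrow> state_sat K (init K) \<phi>"

definition replace_set :: "'p fml \<Rightarrow> 's set \<Rightarrow> 'p fml \<Rightarrow> ('p, 's) atom fml" where
  "replace_set \<psi> Y \<phi> = replace (lift \<psi>) (Atom (States Y)) (lift \<phi>)"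

definition bisimulation ::
    "'p set \<Rightarrow> ('p, 's) kripke \<Rightarrow> ('p, 't) kripke \<Rightarrow> ('s \<times> 't) set \<Rightarrow> bool" where
  "bisimulation X K K' \<rho> \<longleftrightarrow>
     \<rho> \<subseteq> states K \<times> states K' \<and>
     (\<forall>(s, s') \<in> \<rho>.
        label K s \<inter> X = label K' s' \<inter> X \<and>
        (\<forall>t'. (s', t') \<in> trans_rel K' \<longrightarrow> (\<exists>t. (s, t) \<in> trans_rel K \<and> (t, t') \<in> \<rho>)) \<and>
        (\<forall>t. (s, t) \<in> trans_rel K \<longrightarrow> (\<exists>t'. (s', t') \<in> trans_rel K' \<and> (t, t') \<in> \<rho>)))"

text \<open>
  \<open>AP K \<subseteq> AP K'\<close> expresses that the propositions \<open>AP K\<close> are common to both structures.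
\<close>

definition bisim_class :: "('p, 's) kripke \<Rightarrow> ('p, 't) kripke set" where
  "bisim_class K =
     {K'. kripke_structure K' \<and> AP K \<subseteq> AP K' \<and>
          (\<exists>\<rho>. bisimulation (AP K) K K' \<rho> \<and> (init K, init K') \<in> \<rho>)}"

definition syntactically_vacuous :: "('p, 's) kripke \<Rightarrow> 'p fml \<Rightarrow> 'p fml \<Rightarrow> bool" where
  "syntactically_vacuous K \<phi> \<psi> \<longleftrightarrow>
     (\<forall>\<psi>' \<in> ctl_star (AP K). K \<Turnstile> lift \<phi> \<longleftrightarrow> K \<Turnstile> lift (replace \<psi> \<psi>' \<phi>))"

definition structure_vacuous :: "('p, 's) kripke \<Rightarrow> 'p fml \<Rightarrow> 'p fml \<Rightarrow> bool" where
  "structure_vacuous K \<phi> \<psi> \<longleftrightarrow>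
     (\<forall>Y \<subseteq> states K. K \<Turnstile> replace_set \<psi> Y \<phi>) \<or>
     (\<forall>Y \<subseteq> states K. K \<Turnstile> Neg (replace_set \<psi> Y \<phi>))"

text \<open>
  HOL cannot quantify over the state type of \<open>K'\<close>. Since state spaces are finite, every
  Kripke structure is isomorphic to one whose states are natural numbers, so letting \<open>K'\<close>
  range over these covers the whole bisimulation class.
\<close>

definition bisimulation_vacuous :: "('p, 's) kripke \<Rightarrow> 'p fml \<Rightarrow> 'p fml \<Rightarrow> bool" where
  "bisimulation_vacuous K \<phi> \<psi> \<longleftrightarrow>
     (\<forall>K' \<in> (bisim_class K :: ('p, nat) kripke set).
        \<forall>Y \<subseteq> states K'. K' \<Turnstile> replace_set \<psi> Y \<phi>) \<or>
     (\<forall>K' \<in> (bisim_class K :: ('p, nat) kripke set).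
        \<forall>Y \<subseteq> states K'. K' \<Turnstile> Neg (replace_set \<psi> Y \<phi>))"

end

theory Submission
  imports Defs
begin

text \<open>
  Structure vacuity is immediate once \<open>K\<close> is copied along an injection of its state space into
  \<open>nat\<close>: the copy lies in the bisimulation class. Syntactic vacuity then follows from structure
  vacuity, because replacing \<open>\<psi>\<close> by a state formula \<open>\<psi>'\<close> amounts to replacing it by the set of
  states satisfying \<open>\<psi>'\<close>. It remains to recover \<open>\<phi>\<close> itself. If \<open>\<psi>\<close> is a state formula, take
  \<open>\<psi>' = \<psi>\<close>. Otherwise \<open>\<psi>\<close> contains a temporal operator, so in negation normal form it occurs
  only positively, and \<open>\<phi>\<close> lies between \<open>\<phi>[\<psi> \<leftarrow> {}]\<close> and \<open>\<phi>[\<psi> \<leftarrow> S]\<close>.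
\<close>

section \<open>Paths and evaluation along them\<close>

lemma is_path_suffix: "is_path K \<pi> \<Longrightarrow> is_path K (suffix k \<pi>)"
  by (simp add: is_path_def suffix_def)

lemma suffix_comp: "suffix k (h \<circ> \<pi>) = h \<circ> suffix k \<pi>"
  by (simp add: suffix_def fun_eq_iff)

lemma is_path_in_states: "kripke_structure K \<Longrightarrow> is_path K \<pi> \<Longrightarrow> \<pi> i \<in> states K"
  by (auto simp: kripke_structure_def is_path_def)

text \<open>Totality of the transition relation yields a successor function on the states; iterating
  it from \<open>s\<close> gives the path.\<close>

lemma ex_path_from:
  assumes "kripke_structure K" and "s \<in> states K"
  shows "\<exists>\<pi>. is_path K \<pi> \<and> \<pi> 0 = s"
proof -
  obtain nxt where nxt: "\<And>s. s \<in> states K \<Longrightarrow> (s, nxt s) \<in> trans_rel K"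
    using assms(1) unfolding kripke_structure_def by metis
  have "(nxt ^^ i) s \<in> states K" for i
    using assms nxt by (induction i) (auto simp: kripke_structure_def)
  then have "is_path K (\<lambda>i. (nxt ^^ i) s)"
    by (simp add: is_path_def nxt)
  then show ?thesis
    by (intro exI[of _ "\<lambda>i. (nxt ^^ i) s"]) simp
qed

text \<open>Subformulas of a state formula need not be state formulas, so the inductions below run
  over \<open>path_sat\<close>. Their results return to \<open>models\<close> along any path that
  starts at the initial state.\<close>

lemma models_iff_path_sat:
  "state_formula \<chi> \<Longrightarrow> \<pi> 0 = init K \<Longrightarrow> K \<Turnstile> \<chi> \<longleftrightarrow> path_sat K \<pi> \<chi>"
  by (simp add: models_def path_sat_state_formula)

section \<open>Lifting and substitution\<close>

lemma lift_eq_iff [simp]: "lift f = lift g \<longleftrightarrow> f = g"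
  by (rule inj_eq, rule fml.inj_map) (simp add: inj_def)

text \<open>On a lifted formula, \<open>replace\<close> tests equality with
  \<open>lift \<psi>\<close> after simplification has pushed \<open>lift\<close> down to the
  arguments. Injectivity of \<open>lift\<close> is therefore recorded constructor by
  constructor.\<close>

lemma lift_eq_simps:
  "Atom (Prop a) = lift \<psi> \<longleftrightarrow> Atom a = \<psi>"
  "Neg (lift f) = lift \<psi> \<longleftrightarrow> Neg f = \<psi>"
  "And (lift f) (lift g) = lift \<psi> \<longleftrightarrow> And f g = \<psi>"
  "Or (lift f) (lift g) = lift \<psi> \<longleftrightarrow> Or f g = \<psi>"
  "AllPaths (lift f) = lift \<psi> \<longleftrightarrow> AllPaths f = \<psi>"
  "ExPath (lift f) = lift \<psi> \<longleftrightarrow> ExPath f = \<psi>"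
  "Next (lift f) = lift \<psi> \<longleftrightarrow> Next f = \<psi>"
  "Until (lift f) (lift g) = lift \<psi> \<longleftrightarrow> Until f g = \<psi>"
  "Release (lift f) (lift g) = lift \<psi> \<longleftrightarrow> Release f g = \<psi>"
  "Finally (lift f) = lift \<psi> \<longleftrightarrow> Finally f = \<psi>"
  "Globally (lift f) = lift \<psi> \<longleftrightarrow> Globally f = \<psi>"
  by (metis fml.map lift_eq_iff)+

lemma lift_replace: "lift (replace \<psi> y \<phi>) = replace (lift \<psi>) (lift y) (lift \<phi>)"
  by (induction \<phi>) (simp_all add: lift_eq_simps)

lemma replace_set_simps:
  "replace_set \<psi> Y (Atom a) = (if Atom a = \<psi> then Atom (States Y) else Atom (Prop a))"
  "replace_set \<psi> Y (Neg f) =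
     (if Neg f = \<psi> then Atom (States Y) else Neg (replace_set \<psi> Y f))"
  "replace_set \<psi> Y (And f g) =
     (if And f g = \<psi> then Atom (States Y) else And (replace_set \<psi> Y f) (replace_set \<psi> Y g))"
  "replace_set \<psi> Y (Or f g) =
     (if Or f g = \<psi> then Atom (States Y) else Or (replace_set \<psi> Y f) (replace_set \<psi> Y g))"
  "replace_set \<psi> Y (AllPaths f) =
     (if AllPaths f = \<psi> then Atom (States Y) else AllPaths (replace_set \<psi> Y f))"
  "replace_set \<psi> Y (ExPath f) =
     (if ExPath f = \<psi> then Atom (States Y) else ExPath (replace_set \<psi> Y f))"
  "replace_set \<psi> Y (Next f) =
     (if Next f = \<psi> then Atom (States Y) else Next (replace_set \<psi> Y f))"
  "replace_set \<psi> Y (Until f g) =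
     (if Until f g = \<psi> then Atom (States Y) else Until (replace_set \<psi> Y f) (replace_set \<psi> Y g))"
  "replace_set \<psi> Y (Release f g) =
     (if Release f g = \<psi> then Atom (States Y) else Release (replace_set \<psi> Y f) (replace_set \<psi> Y g))"
  "replace_set \<psi> Y (Finally f) =
     (if Finally f = \<psi> then Atom (States Y) else Finally (replace_set \<psi> Y f))"
  "replace_set \<psi> Y (Globally f) =
     (if Globally f = \<psi> then Atom (States Y) else Globally (replace_set \<psi> Y f))"
  by (simp_all add: replace_set_def lift_eq_simps)

lemma state_formula_lift [simp]: "state_formula (lift f) \<longleftrightarrow> state_formula f"
  by (induction f) auto

lemma universal_nnf_lift: "universal_nnf f \<Longrightarrow> universal_nnf (lift f)"
  by (induction f) auto

lemma state_formula_replace: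
  "state_formula \<phi> \<Longrightarrow> state_formula y \<Longrightarrow> state_formula (replace \<psi> y \<phi>)"
  by (induction \<phi>) auto

lemma replace_self: "replace \<psi> \<psi> \<phi> = \<phi>"
  by (induction \<phi>) auto

text \<open>Agreement on paths of \<open>K\<close> is enough: evaluation moves only to suffixes of a
  path or to paths bound by a quantifier, and these are again paths of \<open>K\<close>.\<close>

lemma path_sat_replace_cong:
  assumes "\<And>\<pi>. is_path K \<pi> \<Longrightarrow> path_sat K \<pi> x \<longleftrightarrow> path_sat K \<pi> y" and "is_path K \<pi>"
  shows "path_sat K \<pi> (replace \<psi> x \<phi>) \<longleftrightarrow> path_sat K \<pi> (replace \<psi> y \<phi>)"
  using assms(2) by (induction \<phi> arbitrary: \<pi>) (auto simp: assms(1) is_path_suffix)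

text \<open>In negation normal form only atoms are negated, and both an atom and its negation are
  state formulas. Hence \<psi> never lies under a negation, and every other connective that is
  allowed is monotone.\<close>

lemma path_sat_replace_mono:
  assumes "\<And>\<pi>. is_path K \<pi> \<Longrightarrow> path_sat K \<pi> x \<Longrightarrow> path_sat K \<pi> y"
    and "\<not> state_formula \<psi>"
    and "universal_nnf \<phi>" and "is_path K \<pi>" and "path_sat K \<pi> (replace \<psi> x \<phi>)"
  shows "path_sat K \<pi> (replace \<psi> y \<phi>)"
  using assms(3-)
proof (induction \<phi> arbitrary: \<pi>)
  case (Neg f)
  then obtain a where "f = Atom a" by auto
  \<comment> \<open>Neither \<open>Atom a\<close> nor \<open>Neg (Atom a)\<close> can equal \<psi>,
    so both substitutions leave this formula unchanged.\<close>
  with assms(2) Neg.prems show ?case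
    by (auto split: if_splits)
next
  case (Next f)
  with assms(1) show ?case
    by (simp add: is_path_suffix split: if_splits)
next
  case (Until f g)
  then have "path_sat K (suffix k \<pi>) (replace \<psi> x f) \<Longrightarrow> path_sat K (suffix k \<pi>) (replace \<psi> y f)"
    "path_sat K (suffix k \<pi>) (replace \<psi> x g) \<Longrightarrow> path_sat K (suffix k \<pi>) (replace \<psi> y g)" for k
    by (simp_all add: is_path_suffix)
  with Until.prems(2,3) show ?case
    by (cases "Until f g = \<psi>") (auto intro: assms(1))
next
  case (Release f g)
  then have "path_sat K (suffix k \<pi>) (replace \<psi> x f) \<Longrightarrow> path_sat K (suffix k \<pi>) (replace \<psi> y f)"
    "path_sat K (suffix k \<pi>) (replace \<psi> x g) \<Longrightarrow> path_sat K (suffix k \<pi>) (replace \<psi> y g)" for k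
    by (simp_all add: is_path_suffix)
  with Release.prems(2,3) show ?case
    by (cases "Release f g = \<psi>") (auto intro: assms(1))
next
  case (Finally f)
  then have "path_sat K (suffix k \<pi>) (replace \<psi> x f) \<Longrightarrow> path_sat K (suffix k \<pi>) (replace \<psi> y f)" for k
    by (simp add: is_path_suffix)
  with Finally.prems(2,3) show ?case
    by (cases "Finally f = \<psi>") (auto intro: assms(1))
next
  case (Globally f)
  then have "path_sat K (suffix k \<pi>) (replace \<psi> x f) \<Longrightarrow> path_sat K (suffix k \<pi>) (replace \<psi> y f)" for k
    by (simp add: is_path_suffix)
  with Globally.prems(2,3) show ?case
    by (cases "Globally f = \<psi>") (auto intro: assms(1))
qed (use assms(1) in \<open>auto split: if_splits\<close>)

section \<open>Copying a structure along an injection\<close>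

definition map_states :: "('s \<Rightarrow> 't) \<Rightarrow> ('p, 's) kripke \<Rightarrow> ('p, 't) kripke" where
  "map_states h K =
     \<lparr>AP = AP K, states = h ` states K, trans_rel = map_prod h h ` trans_rel K,
      init = h (init K), label = (\<lambda>t. label K (inv_into (states K) h t))\<rparr>"

lemma map_states_simps [simp]:
  "AP (map_states h K) = AP K"
  "states (map_states h K) = h ` states K"
  "trans_rel (map_states h K) = map_prod h h ` trans_rel K"
  "init (map_states h K) = h (init K)"
  "label (map_states h K) t = label K (inv_into (states K) h t)"
  by (simp_all add: map_states_def)

text \<open>The graph of \<open>h\<close> on the states is a bisimulation; injectivity makes the
  labels agree and gives the backward condition.\<close>

lemma map_states_in_bisim_class:
  assumes K: "kripke_structure K" and h: "inj_on h (states K)"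
  shows "map_states h K \<in> bisim_class K"
proof -
  have R: "\<And>s t. (s, t) \<in> trans_rel K \<Longrightarrow> s \<in> states K \<and> t \<in> states K"
    using K by (auto simp: kripke_structure_def)
  have "kripke_structure (map_states h K)"
    unfolding kripke_structure_def
  proof (intro conjI ballI)
    fix t assume "t \<in> states (map_states h K)"
    then obtain s where s: "s \<in> states K" "t = h s" by auto
    then obtain u where "(s, u) \<in> trans_rel K"
      using K by (auto simp: kripke_structure_def)
    then show "\<exists>u. (t, u) \<in> trans_rel (map_states h K)"
      using s by force
    show "label (map_states h K) t \<subseteq> AP (map_states h K)"
      using s h K by (simp add: kripke_structure_def)
  qed (use K R in \<open>auto simp: kripke_structure_def\<close>)
  moreover have "bisimulation (AP K) K (map_states h K) {(s, h s) | s. s \<in> states K}"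
    unfolding bisimulation_def
  proof (intro conjI ballI, safe)
    fix s t' assume "s \<in> states K" "(h s, t') \<in> trans_rel (map_states h K)"
    then obtain s' t where "(s', t) \<in> trans_rel K" "h s = h s'" "t' = h t" by auto
    \<comment> \<open>The transition of the copy comes from some \<open>s'\<close> with the same
      image as \<open>s\<close>; without injectivity it might not start at \<open>s\<close>.\<close>
    moreover from this have "s = s'"
      using R h \<open>s \<in> states K\<close> by (meson inj_onD)
    ultimately show "\<exists>t. (s, t) \<in> trans_rel K \<and> (t, t') \<in> {(s, h s) | s. s \<in> states K}"
      using R by blast
  next
    fix s t assume "(s, t) \<in> trans_rel K"
    then show "\<exists>t'. (h s, t') \<in> trans_rel (map_states h K)
        \<and> (t, t') \<in> {(s, h s) | s. s \<in> states K}"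
      using R by force
  qed (use h in auto)
  moreover have "(init K, init (map_states h K)) \<in> {(s, h s) | s. s \<in> states K}"
    using K by (simp add: kripke_structure_def)
  ultimately show ?thesis
    unfolding bisim_class_def by auto
qed

lemma paths_map_states:
  assumes K: "kripke_structure K" and h: "inj_on h (states K)" and s: "s \<in> states K"
  shows "{\<pi>. is_path (map_states h K) \<pi> \<and> \<pi> 0 = h s}
           = (\<circ>) h ` {\<pi>. is_path K \<pi> \<and> \<pi> 0 = s}"
proof (intro equalityI subsetI)
  fix \<pi> assume "\<pi> \<in> {\<pi>. is_path (map_states h K) \<pi> \<and> \<pi> 0 = h s}"
  then have \<pi>: "\<And>i. (\<pi> i, \<pi> (Suc i)) \<in> map_prod h h ` trans_rel K" "\<pi> 0 = h s"
    by (auto simp: is_path_def)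
  \<comment> \<open>Choosing a preimage of each transition separately need not give matching
    endpoints. Inverting state by state makes consecutive transitions meet.\<close>
  define \<sigma> where "\<sigma> = inv_into (states K) h \<circ> \<pi>"
  have step: "(\<sigma> i, \<sigma> (Suc i)) \<in> trans_rel K \<and> h (\<sigma> i) = \<pi> i" for i
  proof -
    obtain a b where ab: "(a, b) \<in> trans_rel K" "\<pi> i = h a" "\<pi> (Suc i) = h b"
      using \<pi>(1)[of i] by auto
    then have "a \<in> states K" "b \<in> states K"
      using K by (auto simp: kripke_structure_def)
    then show ?thesis
      using ab h by (simp add: \<sigma>_def)
  qed
  have "\<sigma> 0 = s"
    using \<pi>(2) h s by (simp add: \<sigma>_def)
  with step show "\<pi> \<in> (\<circ>) h ` {\<pi>. is_path K \<pi> \<and> \<pi> 0 = s}"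
    by (intro image_eqI[of _ _ \<sigma>]) (auto simp: is_path_def)
next
  have "(h a, h b) \<in> map_prod h h ` trans_rel K" if "(a, b) \<in> trans_rel K" for a b
    using that by force
  then show "\<pi> \<in> {\<pi>. is_path (map_states h K) \<pi> \<and> \<pi> 0 = h s}"
    if "\<pi> \<in> (\<circ>) h ` {\<pi>. is_path K \<pi> \<and> \<pi> 0 = s}" for \<pi>
    using that by (auto simp: is_path_def)
qed

lemma path_sat_map_states:
  assumes K: "kripke_structure K" and h: "inj_on h (states K)" and Y: "Y \<subseteq> states K"
    and "is_path K \<pi>"
  shows "path_sat (map_states h K) (h \<circ> \<pi>) (replace_set \<psi> (h ` Y) \<phi>)
           \<longleftrightarrow> path_sat K \<pi> (replace_set \<psi> Y \<phi>)"
  using assms(4)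
proof (induction \<phi> arbitrary: \<pi>)
  case (Atom a)
  then have "\<pi> 0 \<in> states K"
    using K by (rule is_path_in_states[rotated])
  then show ?case
    using h Y by (simp add: replace_set_simps inj_on_image_mem_iff)
next
  case (AllPaths f)
  have "(\<forall>\<pi>' \<in> {\<pi>'. is_path (map_states h K) \<pi>' \<and> \<pi>' 0 = h (\<pi> 0)}. P \<pi>')
      \<longleftrightarrow> (\<forall>\<pi>'. is_path K \<pi>' \<and> \<pi>' 0 = \<pi> 0 \<longrightarrow> P (h \<circ> \<pi>'))" for P
    unfolding paths_map_states[OF K h is_path_in_states[OF K AllPaths.prems]] by simp
  moreover have "h (\<pi> 0) \<in> h ` Y \<longleftrightarrow> \<pi> 0 \<in> Y"
    using AllPaths.prems K h Y by (simp add: inj_on_image_mem_iff is_path_in_states)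
  ultimately show ?case
    by (simp add: AllPaths.IH replace_set_simps cong: conj_cong imp_cong)
next
  case (ExPath f)
  have "(\<exists>\<pi>' \<in> {\<pi>'. is_path (map_states h K) \<pi>' \<and> \<pi>' 0 = h (\<pi> 0)}. P \<pi>')
      \<longleftrightarrow> (\<exists>\<pi>'. is_path K \<pi>' \<and> \<pi>' 0 = \<pi> 0 \<and> P (h \<circ> \<pi>'))" for P
    unfolding paths_map_states[OF K h is_path_in_states[OF K ExPath.prems]] by simp
  moreover have "h (\<pi> 0) \<in> h ` Y \<longleftrightarrow> \<pi> 0 \<in> Y"
    using ExPath.prems K h Y by (simp add: inj_on_image_mem_iff is_path_in_states)
  ultimately show ?case
    by (simp add: ExPath.IH replace_set_simps cong: conj_cong imp_cong)
qed (use K h Y in \<open>simp_all add: replace_set_simps suffix_comp is_path_suffix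
       inj_on_image_mem_iff is_path_in_states\<close>)

lemma state_formula_replace_set: "state_formula \<phi> \<Longrightarrow> state_formula (replace_set \<psi> Y \<phi>)"
  by (simp add: replace_set_def state_formula_replace)

lemma models_Neg: "K \<Turnstile> Neg \<chi> \<longleftrightarrow> \<not> K \<Turnstile> \<chi>"
  by (simp add: models_def)

section \<open>From bisimulation vacuity to structure and syntactic vacuity\<close>

lemma bisimulation_vacuous_imp_structure_vacuous:
  assumes K: "kripke_structure K" and \<phi>: "state_formula \<phi>" and "bisimulation_vacuous K \<phi> \<psi>"
  shows "structure_vacuous K \<phi> \<psi>"
proof -
  \<comment> \<open>Finiteness of the state space provides the injection into \<open>nat\<close>,
    the state type over which the bisimulation class ranges.\<close>
  obtain h :: "_ \<Rightarrow> nat" where h: "inj_on h (states K)"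
    using K finite_imp_inj_to_nat_seg[of "states K"] by (auto simp: kripke_structure_def)
  obtain \<pi> where \<pi>: "is_path K \<pi>" "\<pi> 0 = init K"
    using ex_path_from[OF K, of "init K"] K by (auto simp: kripke_structure_def)
  have "map_states h K \<Turnstile> replace_set \<psi> (h ` Y) \<phi> \<longleftrightarrow> K \<Turnstile> replace_set \<psi> Y \<phi>"
    if "Y \<subseteq> states K" for Y
    using path_sat_map_states[OF K h that \<pi>(1)] \<pi>(2) \<phi>
    by (simp add: models_iff_path_sat[of _ \<pi>] models_iff_path_sat[of _ "h \<circ> \<pi>"]
        state_formula_replace_set)
  moreover have "h ` Y \<subseteq> states (map_states h K)" if "Y \<subseteq> states K" for Y
    using that by auto
  ultimately show ?thesis
    using assms(3) map_states_in_bisim_class[OF K h]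
    unfolding bisimulation_vacuous_def structure_vacuous_def models_Neg by metis
qed

text \<open>The truth of a state formula on a path depends only on the first state. So \<chi> and
  the atom for its set of satisfying states agree on every path of \<open>K\<close>, and the
  congruence for \<open>replace\<close> applies.\<close>

lemma models_replace_iff_replace_set:
  assumes K: "kripke_structure K" and \<phi>: "state_formula \<phi>" and \<chi>: "state_formula \<chi>"
  shows "K \<Turnstile> lift (replace \<psi> \<chi> \<phi>)
           \<longleftrightarrow> K \<Turnstile> replace_set \<psi> {s \<in> states K. state_sat K s (lift \<chi>)} \<phi>"
proof -
  obtain \<pi> where \<pi>: "is_path K \<pi>" "\<pi> 0 = init K"
    using ex_path_from[OF K, of "init K"] K by (auto simp: kripke_structure_def)
  have "path_sat K \<pi> (lift (replace \<psi> \<chi> \<phi>))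
      \<longleftrightarrow> path_sat K \<pi> (replace_set \<psi> {s \<in> states K. state_sat K s (lift \<chi>)} \<phi>)"
    unfolding lift_replace replace_set_def
    using K \<chi> \<pi>(1)
    by (intro path_sat_replace_cong) (auto simp: path_sat_state_formula is_path_in_states)
  then show ?thesis
    using \<phi> \<chi> \<pi>(2)
    by (simp add: models_iff_path_sat[of _ \<pi>] state_formula_replace state_formula_replace_set)
qed

lemma structure_vacuous_imp_syntactically_vacuous:
  assumes K: "kripke_structure K" and \<phi>: "state_formula \<phi>" "universal_nnf \<phi>"
    and vac: "structure_vacuous K \<phi> \<psi>"
  shows "syntactically_vacuous K \<phi> \<psi>"
proof -
  obtain \<pi> where \<pi>: "is_path K \<pi>" "\<pi> 0 = init K"
    using ex_path_from[OF K, of "init K"] K by (auto simp: kripke_structure_def)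
  have const: "K \<Turnstile> replace_set \<psi> Y \<phi> \<longleftrightarrow> K \<Turnstile> replace_set \<psi> Z \<phi>"
    if "Y \<subseteq> states K" "Z \<subseteq> states K" for Y Z
    using vac that unfolding structure_vacuous_def models_Neg by blast
  have "K \<Turnstile> lift \<phi> \<longleftrightarrow> K \<Turnstile> replace_set \<psi> Y \<phi>" if Y: "Y \<subseteq> states K" for Y
  proof (cases "state_formula \<psi>")
    case True
    then show ?thesis
      using models_replace_iff_replace_set[OF K \<phi>(1) True, of \<psi>] const[OF _ Y]
      by (simp add: replace_self)
  next
    case False
    \<comment> \<open>On paths of \<open>K\<close> the atom for \<open>{}\<close> is always false
      and the atom for \<open>states K\<close> always true, so they bound \<psi> from below and
      above. By \<open>const\<close> the two bounds for \<phi> have the same truth value.\<close>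
    note mono = path_sat_replace_mono[of K _ _ "lift \<psi>" "lift \<phi>" \<pi>]
    have "path_sat K \<pi> (replace_set \<psi> {} \<phi>) \<Longrightarrow> path_sat K \<pi> (lift \<phi>)"
      using mono[of "Atom (States {})" "lift \<psi>"] False \<phi>(2) \<pi>(1)
      by (simp add: replace_set_def replace_self universal_nnf_lift)
    moreover have "path_sat K \<pi> (lift \<phi>) \<Longrightarrow> path_sat K \<pi> (replace_set \<psi> (states K) \<phi>)"
      using mono[of "lift \<psi>" "Atom (States (states K))"] False \<phi>(2) \<pi>(1) is_path_in_states[OF K]
      by (simp add: replace_set_def replace_self universal_nnf_lift)
    ultimately show ?thesis
      using const[OF _ Y, of "{}"] const[OF _ Y, of "states K"] \<phi>(1) \<pi>(2)
      by (auto simp: models_iff_path_sat[of _ \<pi>] state_formula_replace_set)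
  qed
  then show ?thesis
    using models_replace_iff_replace_set[OF K \<phi>(1)]
    by (auto simp: syntactically_vacuous_def ctl_star_def)
qed

theorem theorem3p5:
  fixes K :: "('p, 's) kripke" and \<phi> \<psi> :: "'p fml"
  assumes "kripke_structure K"
    and "\<phi> \<in> actl_star (AP K)"
    and "\<psi> \<in> subformulas \<phi>"
    and "bisimulation_vacuous K \<phi> \<psi>"
  shows "structure_vacuous K \<phi> \<psi> \<and> syntactically_vacuous K \<phi> \<psi>"
proof -
  have "state_formula \<phi>" "universal_nnf \<phi>"
    using assms(2) by (auto simp: actl_star_def ctl_star_def)
  with assms(1,4) show ?thesis
    using bisimulation_vacuous_imp_structure_vacuous structure_vacuous_imp_syntactically_vacuous
    by blast
qed

end
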